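(* Let $n\ge 1$, let $A$ be an $n\times n$ matrix with complex entries, and let $k,\ell\ge 0$ be integers. Suppose that the vector $c^{[k]}=(c^{[k]}_1,\ldots,c^{[k]}_n)$ of column sums of $A^k$ and the vector $r^{[\ell]}=(r^{[\ell]}_1,\ldots,r^{[\ell]}_n)$ of row sums of $A^\ell$ are real vectors. If $c^{[k]}$ and $r^{[\ell]}$ are similarly ordered, then \[ \operatorname{sum}\left(A^k\right)\cdot\operatorname{sum}\left(A^\ell\right)\le n\cdot\operatorname{sum}\left(A^{k+\ell}\right). \] If $c^{[k]}$ and $r^{[\ell]}$ are conversely ordered, then the inequality is reversed, i.e. \[ \operatorname{sum}\left(A^k\right)\cdot\operatorname{sum}\left(A^\ell\right)\ge n\cdot\operatorname{sum}\left(A^{k+\ell}\right). \]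
   Context: For an $n\times n$ matrix $B=(b_{ij})$, $\operatorname{sum}(B)=\sum_{i,j=1}^n b_{ij}$ denotes the total sum of its entries. For an $n\times n$ matrix $A$ and an integer $p\ge 0$, $A^p$ is the $p$-th matrix power, with $A^0=I$ the identity matrix; $r^{[p]}_i=\sum_{j=1}^n (A^p)_{ij}$ is the $i$-th row sum of $A^p$ and $c^{[p]}_j=\sum_{i=1}^n (A^p)_{ij}$ is the $j$-th column sum of $A^p$. Two real vectors $a,b\in\mathbb{R}^n$ are called similarly ordered if $(a_i-a_k)(b_i-b_k)\ge 0$ for all $i,k\in\{1,\ldots,n\}$, and conversely ordered if $(a_i-a_k)(b_i-b_k)\le 0$ for all $i,k\in\{1,\ldots,n\}$. *)

theory Defs
  imports "Jordan_Normal_Form.Matrix" "HOL-Library.Complex_Order"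
begin

(* Inequalities between complex numbers use the partial order of Complex_Order:
   x \<le> y iff Re x \<le> Re y and Im x = Im y.  On real numbers it is the usual order,
   and non-real numbers are not made comparable by comparing real parts only. *)

definition row_sums :: "'a :: comm_monoid_add mat \<Rightarrow> 'a vec" where
  "row_sums B = vec (dim_row B) (\<lambda>i. \<Sum>j<dim_col B. B $$ (i, j))"

definition col_sums :: "'a :: comm_monoid_add mat \<Rightarrow> 'a vec" where
  "col_sums B = vec (dim_col B) (\<lambda>j. \<Sum>i<dim_row B. B $$ (i, j))"

definition similarly_ordered :: "real vec \<Rightarrow> real vec \<Rightarrow> bool" where
  "similarly_ordered a b \<longleftrightarrow> dim_vec a = dim_vec b \<and>
     (\<forall>i<dim_vec a. \<forall>k<dim_vec a. (a $ i - a $ k) * (b $ i - b $ k) \<ge> 0)"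

definition conversely_ordered :: "real vec \<Rightarrow> real vec \<Rightarrow> bool" where
  "conversely_ordered a b \<longleftrightarrow> dim_vec a = dim_vec b \<and>
     (\<forall>i<dim_vec a. \<forall>k<dim_vec a. (a $ i - a $ k) * (b $ i - b $ k) \<le> 0)"

end

theory Submission
  imports Defs
begin

(* With c and r the column sums of A^k and the row sums of A^l, the three sums in the theorem are
   sum(A^k) = sum c_j, sum(A^l) = sum r_j and sum(A^(k+l)) = sum c_j r_j.  The claim is
   then Chebyshev's sum inequality, which follows from the Korkine identity
   sum_(i,j) (c_i - c_j) (r_i - r_j) = 2 (n sum c_j r_j - (sum c_j) (sum r_j)). *)

lemma korkine_identity:
  fixes a b :: "'i \<Rightarrow> 'a :: comm_ring_1"
  shows "(\<Sum>i\<in>I. \<Sum>j\<in>I. (a i - a j) * (b i - b j)) =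
    2 * (of_nat (card I) * (\<Sum>i\<in>I. a i * b i) - sum a I * sum b I)"
proof -
  have ab: "(\<Sum>i\<in>I. \<Sum>j\<in>I. a i * b j) = sum a I * sum b I"
    by (simp add: sum_product)
  have ba: "(\<Sum>i\<in>I. \<Sum>j\<in>I. a j * b i) = sum a I * sum b I"
    by (subst sum.swap) (simp add: sum_product)
  have diag: "(\<Sum>i\<in>I. \<Sum>j\<in>I. a i * b i) = of_nat (card I) * (\<Sum>i\<in>I. a i * b i)"
    by (simp add: sum_distrib_left)
  have "(\<Sum>i\<in>I. \<Sum>j\<in>I. (a i - a j) * (b i - b j)) =
      (\<Sum>i\<in>I. \<Sum>j\<in>I. a i * b i + a j * b j - a i * b j - a j * b i)"
    by (simp add: algebra_simps)
  also have "\<dots> = 2 * (of_nat (card I) * (\<Sum>i\<in>I. a i * b i) - sum a I * sum b I)"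
    unfolding sum_subtractf sum.distrib ab ba diag
    \<comment> \<open>Left over is the double sum of \<open>a j * b j\<close>, whose outer summand
      is constant. Unfolding \<open>sum_constant\<close> earlier would rewrite the inner sum that
      \<open>diag\<close> has to match.\<close>
    unfolding sum_constant by (simp add: algebra_simps)
  finally show ?thesis .
qed

lemma pow_mat_add:
  fixes A :: "'a :: semiring_1 mat"
  assumes A: "A \<in> carrier_mat n n"
  shows "A ^\<^sub>m (k + l) = A ^\<^sub>m k * A ^\<^sub>m l"
proof (induction l)
  case 0
  then show ?case using A by simp
next
  case (Suc l)
  then show ?case using A by (simp add: assoc_mult_mat [of _ n n _ n _ n])
qed

lemma sum_mat_row_sums: "sum_mat B = (\<Sum>i<dim_row B. row_sums B $ i)"
  by (simp add: sum_mat_def row_sums_def sum.cartesian_product atLeast0LessThan)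

lemma sum_mat_col_sums: "sum_mat B = (\<Sum>j<dim_col B. col_sums B $ j)"
proof -
  have "sum_mat B = (\<Sum>i<dim_row B. \<Sum>j<dim_col B. B $$ (i, j))"
    by (simp add: sum_mat_def sum.cartesian_product atLeast0LessThan)
  also have "\<dots> = (\<Sum>j<dim_col B. \<Sum>i<dim_row B. B $$ (i, j))"
    by (rule sum.swap)
  finally show ?thesis by (simp add: col_sums_def)
qed

text \<open>Collecting the terms that share the inner index \<open>j\<close> of the matrix product,
  the sum over the two outer indices factors. The factor from \<open>B\<close> stays on the left, as
  entries need not commute.\<close>

lemma sum_mat_mult:
  fixes B C :: "'a :: semiring_0 mat"
  assumes "dim_col B = dim_row C"
  shows "sum_mat (B * C) = (\<Sum>j<dim_row C. col_sums B $ j * row_sums C $ j)"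
proof -
  \<comment> \<open>Taking row sums is multiplication by the all-ones vector, so by associativity
    the row sums of \<open>B * C\<close> are \<open>B\<close> applied to those of
    \<open>C\<close>.\<close>
  have row: "row_sums (B * C) $ i = (\<Sum>j<dim_row C. B $$ (i, j) * row_sums C $ j)"
    if "i < dim_row B" for i
  proof -
    have "row_sums (B * C) $ i = (\<Sum>m<dim_col C. \<Sum>j<dim_row C. B $$ (i, j) * C $$ (j, m))"
      using that assms by (simp add: row_sums_def scalar_prod_def atLeast0LessThan)
    also have "\<dots> = (\<Sum>j<dim_row C. \<Sum>m<dim_col C. B $$ (i, j) * C $$ (j, m))"
      by (rule sum.swap)
    finally show ?thesis by (simp add: row_sums_def sum_distrib_left)
  qed
  have "sum_mat (B * C) = (\<Sum>i<dim_row B. \<Sum>j<dim_row C. B $$ (i, j) * row_sums C $ j)"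
    by (simp add: sum_mat_row_sums row)
  also have "\<dots> = (\<Sum>j<dim_row C. \<Sum>i<dim_row B. B $$ (i, j) * row_sums C $ j)"
    by (rule sum.swap)
  finally show ?thesis using assms by (simp add: col_sums_def sum_distrib_right)
qed

theorem theorem4:
  fixes A :: "complex mat" and n k l :: nat and c r :: "real vec"
  assumes "n \<ge> 1"
    and "A \<in> carrier_mat n n"
    and "col_sums (A ^\<^sub>m k) = map_vec complex_of_real c"
    and "row_sums (A ^\<^sub>m l) = map_vec complex_of_real r"
  shows "(similarly_ordered c r \<longrightarrow>
            sum_mat (A ^\<^sub>m k) * sum_mat (A ^\<^sub>m l) \<le> of_nat n * sum_mat (A ^\<^sub>m (k + l))) \<and>
         (conversely_ordered c r \<longrightarrow>
            sum_mat (A ^\<^sub>m k) * sum_mat (A ^\<^sub>m l) \<ge> of_nat n * sum_mat (A ^\<^sub>m (k + l)))"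
proof -
  have dims: "dim_row (A ^\<^sub>m p) = n" "dim_col (A ^\<^sub>m p) = n" for p
    using assms(2) by simp_all
  \<comment> \<open>The lengths of \<open>c\<close> and \<open>r\<close> are read off from the two
    hypotheses on column and row sums.\<close>
  have dim_c: "dim_vec c = n"
    using arg_cong [OF assms(3), of dim_vec] by (simp only: col_sums_def dims dim_vec index_map_vec)
  have dim_r: "dim_vec r = n"
    using arg_cong [OF assms(4), of dim_vec] by (simp only: row_sums_def dims dim_vec index_map_vec)
  \<comment> \<open>All three complex sums are images of real ones under \<open>of_real\<close>,
    which reduces the claim to real numbers.\<close>
  have sum_k: "sum_mat (A ^\<^sub>m k) = of_real (\<Sum>j<n. c $ j)"
    unfolding sum_mat_col_sums dims assms(3) by (simp add: dim_c)
  have sum_l: "sum_mat (A ^\<^sub>m l) = of_real (\<Sum>j<n. r $ j)"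
    unfolding sum_mat_row_sums dims assms(4) by (simp add: dim_r)
  \<comment> \<open>The power is split with exponent \<open>k\<close> on the left, so that columns
    of the \<open>k\<close>-th power meet rows of the \<open>l\<close>-th.\<close>
  have sum_kl: "sum_mat (A ^\<^sub>m (k + l)) = of_real (\<Sum>j<n. c $ j * r $ j)"
    unfolding pow_mat_add [OF assms(2)] sum_mat_mult [OF trans [OF dims(2) dims(1) [symmetric]]]
      dims assms(3,4)
    by (simp add: dim_c dim_r)
  have korkine: "(\<Sum>i<n. \<Sum>j<n. (c $ i - c $ j) * (r $ i - r $ j)) =
      2 * (real n * (\<Sum>j<n. c $ j * r $ j) - (\<Sum>j<n. c $ j) * (\<Sum>j<n. r $ j))"
    using korkine_identity [of "\<lambda>i. c $ i" "\<lambda>i. r $ i" "{..<n}"] by simp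
  have "(\<Sum>j<n. c $ j) * (\<Sum>j<n. r $ j) \<le> real n * (\<Sum>j<n. c $ j * r $ j)"
    if "similarly_ordered c r"
  proof -
    have "0 \<le> (\<Sum>i<n. \<Sum>j<n. (c $ i - c $ j) * (r $ i - r $ j))"
      using that by (intro sum_nonneg) (simp add: similarly_ordered_def dim_c)
    then show ?thesis by (simp add: korkine)
  qed
  moreover have "(\<Sum>j<n. c $ j) * (\<Sum>j<n. r $ j) \<ge> real n * (\<Sum>j<n. c $ j * r $ j)"
    if "conversely_ordered c r"
  proof -
    have "(\<Sum>i<n. \<Sum>j<n. (c $ i - c $ j) * (r $ i - r $ j)) \<le> 0"
      using that by (intro sum_nonpos) (simp add: conversely_ordered_def dim_c)
    then show ?thesis by (simp add: korkine)
  qed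
  ultimately show ?thesis
    \<comment> \<open>Both sides have imaginary part 0, so the complex order compares real parts.
      Without \<open>of_real_sum\<close> the embedding stays outside the sums, where
      \<open>Re\<close> and \<open>Im\<close> evaluate at once.\<close>
    unfolding sum_k sum_l sum_kl by (simp add: less_eq_complex_def del: of_real_sum)
qed

end
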